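(* Let $p,q\in\mathbb C\setminus\{0\}$, $M,N\in\mathbb N_0$ with $N\le M$, and $x,t,\gamma\in\mathbb C$. Then $$\left[(1-t)^{-\gamma}{}_2F_1\!\left(\begin{matrix}\gamma,\,-x\\ -N\end{matrix};\frac{t}{p(t-1)}\right)\right]_N=\sum_{n=0}^{N}\left(\frac{tq}{p}\right)^n\frac{(-M)_n(\gamma)_n}{(-N)_n\,n!}\left[(1-t)^{-\gamma-n}{}_2F_1\!\left(\begin{matrix}\gamma+n,\,n-M\\ n-N\end{matrix};\frac{-qt}{p(1-t)}\right)\right]_{N-n}K_n(x;q,M).$$
   Context: $\mathbb N_0=\{0,1,2,\dots\}$. Pochhammer symbol: $(a)_n=a(a+1)\cdots(a+n-1)$, $(a)_0=1$. ${}_2F_1\!\left(\begin{matrix}a,\,b\\ c\end{matrix};z\right)=\sum_{k\ge0}\frac{(a)_k(b)_k}{(c)_k}\frac{z^k}{k!}$. Truncated Maclaurin expansion in $t$: $[f(t)]_N=\sum_{k=0}^N\frac{f^{(k)}(0)}{k!}t^k$, i.e. the partial sum through degree $N$ of the power series of $f$ in $t$ about $t=0$ (a polynomial in $t$, hence defined for all $t\in\mathbb C$). When the hypergeometric series inside $[\cdot]_L$ has lower parameter $-L$, only its terms of index $\le L$ (which are well defined) contribute to powers of $t$ of degree $\le L$, and the bracket is computed from these terms only. Krawtchouk polynomials, for $0\le n\le M$: $K_n(x;q,M)=\sum_{k=0}^n\frac{(-n)_k(-x)_k}{(-M)_k\,k!}\,q^{-k}$ (the ${}_2F_1(-n,-x;-M;1/q)$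 understood as the sum up to index $n$). *)

theory Defs
  imports "HOL-Complex_Analysis.Complex_Analysis"
begin

definition hyp2F1_upto :: "nat \<Rightarrow> complex \<Rightarrow> complex \<Rightarrow> complex \<Rightarrow> complex \<Rightarrow> complex" where
  "hyp2F1_upto L a b c z =
     (\<Sum>k\<le>L. pochhammer a k * pochhammer b k / pochhammer c k * (z ^ k / fact k))"

text \<open>The terms of index at most \<open>L\<close> are exactly the well-defined ones, since
  \<open>pochhammer (- of_nat L) k = 0\<close> iff \<open>k > L\<close>.\<close>

definition hyp2F1_negint :: "complex \<Rightarrow> complex \<Rightarrow> nat \<Rightarrow> complex \<Rightarrow> complex" where
  "hyp2F1_negint a b L z = hyp2F1_upto L a b (- of_nat L) z"

definition maclaurin_trunc :: "nat \<Rightarrow> (complex \<Rightarrow> complex) \<Rightarrow> complex \<Rightarrow> complex" where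
  "maclaurin_trunc N f t = (\<Sum>k\<le>N. (deriv ^^ k) f 0 / fact k * t ^ k)"

definition krawtchouk :: "nat \<Rightarrow> complex \<Rightarrow> complex \<Rightarrow> nat \<Rightarrow> complex" where
  "krawtchouk n x q M = hyp2F1_upto n (- of_nat n) (- x) (- of_nat M) (1 / q)"

end

theory Submission imports Defs begin

text \<open>
  Both sides are polynomials in \<open>t\<close> of degree at most \<open>N\<close>, and they are compared coefficient by
  coefficient. The brackets are tractable because the argument \<open>c s / (1 - s)\<close> of the
  hypergeometric sum merges with the prefactor: the \<open>k\<close>-th term becomes
  \<open>s ^ k * (1 - s) powr (- a - k)\<close>, whose binomial series contributes a factor
  \<open>pochhammer (a + k) (m - k)\<close> to degree \<open>m\<close>. Together with the \<open>pochhammer a k\<close> of the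
  hypergeometric sum this gives \<open>pochhammer a m\<close>, which depends on the degree alone
  (\<open>maclaurin_trunc_bracket\<close>).

  On the right-hand side the same merging occurs for all Pochhammer symbols with base points shifted
  by \<open>n\<close>, so that, in terms of the total degree \<open>m\<close> and the shifted index \<open>l = n + k\<close>, the summand
  depends on \<open>n\<close> only through \<open>K\<^sub>n\<close> and the weight \<open>(-1) ^ (l - n) / (n! (l - n)!)\<close> (\<open>shifted_bracket\<close>). Summing
  over \<open>n\<close> first, the Krawtchouk polynomials are hit by the inverse binomial transform. Now
  \<open>K\<^sub>n\<close> is itself the binomial transform of the sequence
  \<open>pochhammer (- x) i / pochhammer (- M) i * (- 1 / q) ^ i\<close>, so the sum over \<open>n\<close> returns the
  \<open>l\<close>-th entry of that sequence (\<open>krawtchouk_inversion\<close>). In it \<open>pochhammer (- M) l\<close> and the powers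
  of \<open>q\<close> cancel against the rest, and what is left is the left-hand side. The condition
  \<open>N \<le> M\<close> is what makes \<open>pochhammer (- M) l\<close> nonzero for every \<open>l\<close> that occurs.
\<close>

section \<open>Maclaurin coefficients of the brackets\<close>

lemma has_fps_expansion_one_minus_powr:
  "(\<lambda>s. (1 - s) powr (- a)) has_fps_expansion Abs_fps (\<lambda>j. pochhammer a j / fact j)"
  for a :: complex
proof -
  have "((\<lambda>s. (1 + s) powr (- a)) \<circ> (\<lambda>s. - 1 * s)) has_fps_expansion
          fps_compose (fps_binomial (- a)) (fps_const (- 1) * fps_X)"
    by (intro has_fps_expansion_compose has_fps_expansion_binomial_complex
          has_fps_expansion_cmult_left has_fps_expansion_fps_X) auto
  moreover have "fps_compose (fps_binomial (- a)) (fps_const (- 1) * fps_X)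
      = Abs_fps (\<lambda>j. pochhammer a j / fact j)"
    by (simp add: fps_compose_linear fps_eq_iff gbinomial_pochhammer flip: power_mult_distrib)
  ultimately show ?thesis by (simp add: o_def)
qed

text \<open>
  Expanding \<open>s ^ k * (1 - s) powr (- a - k)\<close> for each \<open>k\<close> yields the coefficient
  \<open>pochhammer a k * pochhammer (a + k) (m - k)\<close> in degree \<open>m\<close>, and this product is
  \<open>pochhammer a m\<close> for every \<open>k\<close>, so it can be taken out of the inner sum. Terms with \<open>k > m\<close>
  start in too high a degree to contribute.
\<close>

lemma maclaurin_trunc_bracket:
  "maclaurin_trunc N (\<lambda>s. (1 - s) powr (- a) * hyp2F1_negint a b N (c * (s / (1 - s)))) t =
   (\<Sum>m\<le>N. pochhammer a m * t ^ m *
     (\<Sum>k\<le>m. pochhammer b k / pochhammer (- of_nat N) k * c ^ k / (fact k * fact (m - k))))"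
proof -
  define d where "d k = pochhammer b k / pochhammer (- of_nat N) k * c ^ k / fact k" for k
  define F where "F = (\<Sum>k\<le>N. fps_const (pochhammer a k * d k) *
      (fps_X ^ k * Abs_fps (\<lambda>j. pochhammer (a + of_nat k) j / fact j)))"
  have "(\<lambda>s. \<Sum>k\<le>N. pochhammer a k * d k * (s ^ k * (1 - s) powr (- (a + of_nat k))))
          has_fps_expansion F"
    unfolding F_def
    by (intro has_fps_expansion_sum has_fps_expansion_cmult_left has_fps_expansion_mult
        has_fps_expansion_fps_X_power has_fps_expansion_one_minus_powr)
  also have "?this \<longleftrightarrow> (\<lambda>s. (1 - s) powr (- a) * hyp2F1_negint a b N (c * (s / (1 - s))))
          has_fps_expansion F"
  proof (rule has_fps_expansion_cong)
    \<comment> \<open>Near \<open>0\<close> the base \<open>1 - s\<close> is nonzero, so subtracting \<open>k\<close> in the exponent is dividing by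
      the \<open>k\<close>-th power, whichever branch of the power is taken.\<close>
    have "\<forall>\<^sub>F s in nhds 0. s \<noteq> (1::complex)"
      by (rule t1_space_nhds) simp
    then show "\<forall>\<^sub>F s in nhds 0. (\<Sum>k\<le>N. pochhammer a k * d k * (s ^ k * (1 - s) powr (- (a + of_nat k))))
        = (1 - s) powr (- a) * hyp2F1_negint a b N (c * (s / (1 - s)))"
    proof eventually_elim
      case (elim s)
      have "(1 - s) powr (- (a + of_nat k)) = (1 - s) powr (- a) / (1 - s) ^ k" for k
        using elim by (simp add: powr_diff powr_nat)
      then show ?case
        by (simp add: hyp2F1_negint_def hyp2F1_upto_def d_def sum_distrib_left
            power_mult_distrib power_divide mult_ac)
    qed
  qed simp
  finally have "maclaurin_trunc N (\<lambda>s. (1 - s) powr (- a) * hyp2F1_negint a b N (c * (s / (1 - s)))) t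
      = (\<Sum>m\<le>N. fps_nth F m * t ^ m)"
    unfolding maclaurin_trunc_def by (simp add: fps_nth_fps_expansion)
  also have "\<dots> = (\<Sum>m\<le>N. pochhammer a m * t ^ m * (\<Sum>k\<le>m. d k / fact (m - k)))"
  proof (rule sum.cong)
    fix m assume m: "m \<in> {..N}"
    have "fps_nth F m = (\<Sum>k\<le>N. if m < k then 0 else
        pochhammer a k * d k * (pochhammer (a + of_nat k) (m - k) / fact (m - k)))"
      unfolding F_def fps_sum_nth
      by (intro sum.cong) (auto simp: fps_X_power_mult_nth)
    also have "\<dots> = (\<Sum>k\<le>m. pochhammer a k * d k * (pochhammer (a + of_nat k) (m - k) / fact (m - k)))"
      using m by (intro sum.mono_neutral_cong_right) auto
    also have "\<dots> = (\<Sum>k\<le>m. pochhammer a m * (d k / fact (m - k)))"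
      by (intro sum.cong) (auto simp: pochhammer_product[of _ m a])
    finally show "fps_nth F m * t ^ m = pochhammer a m * t ^ m * (\<Sum>k\<le>m. d k / fact (m - k))"
      by (simp add: sum_distrib_left sum_distrib_right mult_ac)
  qed simp
  finally show ?thesis by (simp add: d_def mult.assoc)
qed

text \<open>
  Each Pochhammer symbol with base point shifted by \<open>n\<close> completes the corresponding factor in front
  of the bracket to an unshifted symbol, by
  \<open>pochhammer z l = pochhammer z n * pochhammer (z + n) (l - n)\<close>, and the powers of \<open>t\<close> and \<open>r\<close>
  combine likewise. In the resulting triple sum the index \<open>n\<close> enters only through the range of
  summation and the signed weight, which is \<open>1 / l!\<close> times the coefficient of the inverse binomial
  transform. For the theorem, \<open>r = q / p\<close> and \<open>b = - M\<close>.
\<close>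

lemma shifted_bracket:
  assumes "n \<le> N"
  shows "(t * r) ^ n
      * (pochhammer b n * pochhammer \<gamma> n / (pochhammer (- of_nat N) n * fact n))
      * maclaurin_trunc (N - n)
          (\<lambda>s. (1 - s) powr (- \<gamma> - of_nat n)
             * hyp2F1_negint (\<gamma> + of_nat n) (of_nat n + b) (N - n) (- r * (s / (1 - s)))) t
    = (\<Sum>m=n..N. \<Sum>l=n..m. pochhammer \<gamma> m * t ^ m *
        (pochhammer b l / pochhammer (- of_nat N) l * r ^ l / fact (m - l)
          * ((-1) ^ (l - n) / (fact n * fact (l - n)))))"
proof -
  have "(- \<gamma> - of_nat n) = - (\<gamma> + of_nat n)" "of_nat n + b = b + of_nat n" by simp_all
  then have "maclaurin_trunc (N - n)
          (\<lambda>s. (1 - s) powr (- \<gamma> - of_nat n)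
             * hyp2F1_negint (\<gamma> + of_nat n) (of_nat n + b) (N - n) (- r * (s / (1 - s)))) t
      = (\<Sum>m\<le>N - n. pochhammer (\<gamma> + of_nat n) m * t ^ m *
          (\<Sum>k\<le>m. pochhammer (b + of_nat n) k / pochhammer (- of_nat (N - n)) k * (- r) ^ k
             / (fact k * fact (m - k))))"
    by (simp only: maclaurin_trunc_bracket)
  also have "\<dots> = (\<Sum>m=n..N. pochhammer (\<gamma> + of_nat n) (m - n) * t ^ (m - n) *
          (\<Sum>l=n..m. pochhammer (b + of_nat n) (l - n) / pochhammer (- of_nat (N - n)) (l - n)
             * (- r) ^ (l - n) / (fact (l - n) * fact (m - l))))"
  proof (rule sum.reindex_bij_witness[of _ "\<lambda>m. m - n" "\<lambda>m. m + n"])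
    fix m
    have "(\<Sum>k\<le>m. pochhammer (b + of_nat n) k / pochhammer (- of_nat (N - n)) k * (- r) ^ k
             / (fact k * fact (m - k)))
        = (\<Sum>l=n..m + n. pochhammer (b + of_nat n) (l - n) / pochhammer (- of_nat (N - n)) (l - n)
             * (- r) ^ (l - n) / (fact (l - n) * fact (m + n - l)))"
      by (rule sum.reindex_bij_witness[of _ "\<lambda>l. l - n" "\<lambda>k. k + n"]) auto
    then show "pochhammer (\<gamma> + of_nat n) (m + n - n) * t ^ (m + n - n) *
          (\<Sum>l=n..m + n. pochhammer (b + of_nat n) (l - n) / pochhammer (- of_nat (N - n)) (l - n)
             * (- r) ^ (l - n) / (fact (l - n) * fact (m + n - l)))
        = pochhammer (\<gamma> + of_nat n) m * t ^ m *
          (\<Sum>k\<le>m. pochhammer (b + of_nat n) k / pochhammer (- of_nat (N - n)) k * (- r) ^ k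
             / (fact k * fact (m - k)))"
      by simp
  qed (use assms in auto)
  finally have E: "maclaurin_trunc (N - n)
          (\<lambda>s. (1 - s) powr (- \<gamma> - of_nat n)
             * hyp2F1_negint (\<gamma> + of_nat n) (of_nat n + b) (N - n) (- r * (s / (1 - s)))) t
      = (\<Sum>m=n..N. \<Sum>l=n..m. pochhammer (\<gamma> + of_nat n) (m - n) * t ^ (m - n) *
          (pochhammer (b + of_nat n) (l - n) / pochhammer (- of_nat (N - n)) (l - n)
             * (- r) ^ (l - n) / (fact (l - n) * fact (m - l))))"
    by (simp add: sum_distrib_left)
  show ?thesis
    unfolding E sum_distrib_left
  proof (intro sum.cong refl)
    fix m l assume "m \<in> {n..N}" "l \<in> {n..m}"
    then have nl: "n \<le> m" "n \<le> l" by auto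
    have "- of_nat N + of_nat n = (- of_nat (N - n) :: complex)"
      using assms by simp
    then have N: "pochhammer (- of_nat N :: complex) l
        = pochhammer (- of_nat N) n * pochhammer (- of_nat (N - n)) (l - n)"
      using pochhammer_product[OF nl(2), of "- of_nat N :: complex"] by (simp only:)
    have p: "t ^ m = t ^ n * t ^ (m - n)" "r ^ l = r ^ n * r ^ (l - n)"
      using nl by (simp_all flip: power_add)
    show "(t * r) ^ n * (pochhammer b n * pochhammer \<gamma> n / (pochhammer (- of_nat N) n * fact n))
        * (pochhammer (\<gamma> + of_nat n) (m - n) * t ^ (m - n) *
          (pochhammer (b + of_nat n) (l - n) / pochhammer (- of_nat (N - n)) (l - n)
             * (- r) ^ (l - n) / (fact (l - n) * fact (m - l))))
      = pochhammer \<gamma> m * t ^ m *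
        (pochhammer b l / pochhammer (- of_nat N) l * r ^ l / fact (m - l)
          * ((-1) ^ (l - n) / (fact n * fact (l - n))))"
      by (simp add: pochhammer_product[OF nl(1), of \<gamma>] pochhammer_product[OF nl(2), of b] N p
          power_mult_distrib power_minus[of r] mult_ac)
  qed
qed

section \<open>Binomial inversion of the Krawtchouk polynomials\<close>

text \<open>
  After interchanging the sums, the trinomial revision
  \<open>(l choose n) * (n choose i) = (l choose i) * ((l - i) choose (n - i))\<close> turns the coefficient of
  \<open>u i\<close> into an alternating sum over row \<open>l - i\<close> of Pascal's triangle, which vanishes unless
  \<open>i = l\<close>.
\<close>

lemma binomial_inversion:
  fixes u :: "nat \<Rightarrow> 'a::comm_ring_1"
  shows "(\<Sum>n\<le>l. (-1) ^ (l - n) * of_nat (l choose n) * (\<Sum>i\<le>n. of_nat (n choose i) * u i)) = u l"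
proof -
  have *: "(\<Sum>n=i..l. (-1) ^ (l - n) * of_nat (l choose n) * of_nat (n choose i))
      = (if i = l then 1 else 0 :: 'a)" if "i \<le> l" for i
  proof -
    have "(\<Sum>n=i..l. (-1) ^ (l - n) * of_nat (l choose n) * of_nat (n choose i))
      = (\<Sum>n=i..l. (-1) ^ (l - n) * of_nat (l choose i) * (of_nat ((l - i) choose (n - i)) :: 'a))"
    proof (intro sum.cong refl)
      fix n assume "n \<in> {i..l}"
      then have "of_nat (l choose n) * of_nat (n choose i)
          = (of_nat (l choose i) * of_nat ((l - i) choose (n - i)) :: 'a)"
        using choose_mult[of i n l] by (simp flip: of_nat_mult)
      then show "(-1) ^ (l - n) * of_nat (l choose n) * of_nat (n choose i)
          = (-1) ^ (l - n) * of_nat (l choose i) * (of_nat ((l - i) choose (n - i)) :: 'a)"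
        by (simp add: mult.assoc)
    qed
    also have "\<dots> = (\<Sum>j\<le>l - i. (-1) ^ j * of_nat (l choose i) * of_nat ((l - i) choose j))"
      by (rule sum.reindex_bij_witness[of _ "\<lambda>j. l - j" "\<lambda>n. l - n"])
        (use that in \<open>auto simp: binomial_symmetric[of "_ - i" "l - i"]\<close>)
    also have "\<dots> = of_nat (l choose i) * (\<Sum>j\<le>l - i. (-1) ^ j * of_nat ((l - i) choose j))"
      by (simp add: sum_distrib_left mult_ac)
    also have "\<dots> = (if i = l then 1 else 0)"
      using that by (auto simp: choose_alternating_sum)
    finally show ?thesis .
  qed
  have "(\<Sum>n\<le>l. (-1) ^ (l - n) * of_nat (l choose n) * (\<Sum>i\<le>n. of_nat (n choose i) * u i))
      = (\<Sum>n\<le>l. \<Sum>i\<le>n. (-1) ^ (l - n) * of_nat (l choose n) * of_nat (n choose i) * u i)"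
    by (simp add: sum_distrib_left mult_ac)
  also have "\<dots> = (\<Sum>i\<le>l. \<Sum>n=i..l. (-1) ^ (l - n) * of_nat (l choose n) * of_nat (n choose i) * u i)"
    by (simp add: sum.Sigma, rule sum.reindex_bij_witness[of _ prod.swap prod.swap]) auto
  also have "\<dots> = (\<Sum>i\<le>l. if i = l then u i else 0)"
    by (intro sum.cong) (auto simp: * simp flip: sum_distrib_right)
  finally show ?thesis by simp
qed

lemma pochhammer_neg_of_nat:
  "pochhammer (- of_nat n) i = (-1) ^ i * fact i * (of_nat (n choose i) :: complex)"
  by (simp add: binomial_gbinomial gbinomial_pochhammer flip: power_mult_distrib)

lemma krawtchouk_eq_binomial_sum:
  "krawtchouk n x q M =
     (\<Sum>i\<le>n. of_nat (n choose i) * (pochhammer (- x) i / pochhammer (- of_nat M) i * (- 1 / q) ^ i))"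
  by (simp add: krawtchouk_def hyp2F1_upto_def pochhammer_neg_of_nat[of n] power_divide
      power_minus[of "1 / q"] mult_ac)

lemma krawtchouk_inversion:
  "(\<Sum>n\<le>l. (-1) ^ (l - n) / (fact n * fact (l - n)) * krawtchouk n x q M) =
     pochhammer (- x) l / pochhammer (- of_nat M) l * (- 1 / q) ^ l / fact l"
proof -
  have "(\<Sum>n\<le>l. (-1) ^ (l - n) / (fact n * fact (l - n)) * krawtchouk n x q M)
      = (\<Sum>n\<le>l. (-1) ^ (l - n) * of_nat (l choose n) * krawtchouk n x q M) / fact l"
    by (simp add: sum_divide_distrib binomial_fact)
  then show ?thesis
    by (simp only: krawtchouk_eq_binomial_sum binomial_inversion)
qed

section \<open>The expansion in Krawtchouk polynomials\<close>

theorem theorem16: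
  fixes p q x t \<gamma> :: complex and M N :: nat
  assumes "p \<noteq> 0" and "q \<noteq> 0" and "N \<le> M"
  shows
    "maclaurin_trunc N
       (\<lambda>s. (1 - s) powr (- \<gamma>) * hyp2F1_negint \<gamma> (- x) N (s / (p * (s - 1)))) t =
     (\<Sum>n = 0..N. (t * q / p) ^ n
        * (pochhammer (- of_nat M) n * pochhammer \<gamma> n / (pochhammer (- of_nat N) n * fact n))
        * maclaurin_trunc (N - n)
            (\<lambda>s. (1 - s) powr (- \<gamma> - of_nat n)
                 * hyp2F1_negint (\<gamma> + of_nat n) (of_nat n - of_nat M) (N - n)
                     (- q * s / (p * (1 - s)))) t
        * krawtchouk n x q M)"
  (is "?lhs = (\<Sum>n = 0..N. ?summand n * krawtchouk n x q M)")
proof -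
  define w where "w m l = pochhammer (- of_nat M) l / pochhammer (- of_nat N) l * (q / p) ^ l
      / (fact (m - l) :: complex)" for m l
  define g where "g m = pochhammer \<gamma> m * t ^ m" for m
  have summand: "?summand n = (\<Sum>m=n..N. \<Sum>l=n..m. g m * (w m l * ((-1) ^ (l - n) / (fact n * fact (l - n)))))"
    if "n \<in> {0..N}" for n
    using shifted_bracket[of n N t "q / p" "- of_nat M" \<gamma>] that
    by (simp add: g_def w_def)
  have "(\<Sum>n = 0..N. ?summand n * krawtchouk n x q M)
      = (\<Sum>n = 0..N. \<Sum>m=n..N. \<Sum>l=n..m. g m * (w m l *
           ((-1) ^ (l - n) / (fact n * fact (l - n)) * krawtchouk n x q M)))"
    by (intro sum.cong refl, subst summand) (simp_all only: sum_distrib_right mult.assoc)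
  \<comment> \<open>The summation region \<open>n \<le> l \<le> m \<le> N\<close> is reordered so that \<open>n\<close> is innermost and the inversion
    formula for the Krawtchouk polynomials applies.\<close>
  also have "\<dots> = (\<Sum>m\<le>N. \<Sum>l\<le>m. \<Sum>n\<le>l. g m * (w m l *
           ((-1) ^ (l - n) / (fact n * fact (l - n)) * krawtchouk n x q M)))"
    by (simp add: sum.Sigma,
        rule sum.reindex_bij_witness[of _ "\<lambda>(m, l, n). (n, m, l)" "\<lambda>(n, m, l). (m, l, n)"]) auto
  also have "\<dots> = (\<Sum>m\<le>N. g m * (\<Sum>l\<le>m. w m l *
           (pochhammer (- x) l / pochhammer (- of_nat M) l * (- 1 / q) ^ l / fact l)))"
    by (simp only: krawtchouk_inversion flip: sum_distrib_left)
  also have "\<dots> = (\<Sum>m\<le>N. g m * (\<Sum>l\<le>m.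
           pochhammer (- x) l / pochhammer (- of_nat N) l * (- 1 / p) ^ l / (fact l * fact (m - l))))"
  proof (intro sum.cong refl arg_cong[of _ _ "\<lambda>y. _ * y"])
    fix m l assume "m \<in> {..N}" "l \<in> {..m}"
    with assms have "pochhammer (- of_nat M :: complex) l \<noteq> 0"
      by (simp add: pochhammer_of_nat_eq_0_iff)
    moreover have pow: "(- 1 / p) ^ l = (q / p) ^ l * (- 1 / q) ^ l"
      using assms by (simp flip: power_mult_distrib)
    ultimately show "w m l * (pochhammer (- x) l / pochhammer (- of_nat M) l * (- 1 / q) ^ l / fact l)
        = pochhammer (- x) l / pochhammer (- of_nat N) l * (- 1 / p) ^ l / (fact l * fact (m - l))"
      unfolding w_def pow by (simp add: mult_ac)
  qed
  also have "\<dots> = maclaurin_trunc N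
      (\<lambda>s. (1 - s) powr (- \<gamma>) * hyp2F1_negint \<gamma> (- x) N (- 1 / p * (s / (1 - s)))) t"
    by (simp only: maclaurin_trunc_bracket g_def)
  finally have "(\<Sum>n = 0..N. ?summand n * krawtchouk n x q M) = maclaurin_trunc N
      (\<lambda>s. (1 - s) powr (- \<gamma>) * hyp2F1_negint \<gamma> (- x) N (- 1 / p * (s / (1 - s)))) t" .
  moreover have "- 1 / p * (s / (1 - s)) = s / (p * (s - 1))" for s
    using minus_divide_right[of s "p * (1 - s)"] by (simp add: algebra_simps)
  ultimately show ?thesis by (simp only:)
qed

end
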